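(* Let $k$ be a nonzero commutative unital ring. The unital associative $k$-algebra defined by generators $A,B,C$ and relations $ABCA=BCAB=CABC$, $A^2=B^2=C^2=0$ is not finitely generated as a $k$-module. The same holds if the relations $A^2=B^2=C^2=0$ are replaced by $A^2=A$, $B^2=B$, $C^2=C$. *)

theory Defs
  imports Complex_Main "HOL-Library.Poly_Mapping"
begin

text \<open>Lists under concatenation form the free monoid. Written additively, this makes
  \<^typ>\<open>'x list \<Rightarrow>\<^sub>0 'k\<close>, with the convolution product of \<^theory>\<open>HOL-Library.Poly_Mapping\<close>,
  the free unital associative \<open>'k\<close>-algebra on \<open>'x\<close>.\<close>

instantiation list :: (type) monoid_add
begin

definition zero_list :: "'a list" where
  "zero_list = []"

definition plus_list :: "'a list \<Rightarrow> 'a list \<Rightarrow> 'a list" where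
  "plus_list = (@)"

instance
  by standard (simp_all add: zero_list_def plus_list_def)

end

type_synonym ('x, 'k) free_alg = "'x list \<Rightarrow>\<^sub>0 'k"

definition var :: "'x \<Rightarrow> ('x, 'k::comm_ring_1) free_alg" where
  "var x = Poly_Mapping.single [x] 1"

definition free_scale :: "'k::comm_ring_1 \<Rightarrow> ('x, 'k) free_alg \<Rightarrow> ('x, 'k) free_alg" where
  "free_scale c f = Poly_Mapping.single [] c * f"

lemma free_alg_induct [case_names zero add]:
  fixes f :: "('x, 'k::comm_ring_1) free_alg"
  assumes zero: "P 0"
    and add: "\<And>w c f. P f \<Longrightarrow> P (Poly_Mapping.single w c + f)"
  shows "P f"
proof (induction f rule: update_induct)
  case const
  show ?case by (rule zero)
next
  case (update f w c)
  have "Poly_Mapping.update w c f = Poly_Mapping.single w c + f"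
    using update.hyps
    by (intro poly_mapping_eqI)
      (auto simp: lookup_update lookup_add lookup_single in_keys_iff when_def)
  then show ?case using update.IH add by simp
qed

lemma single_Nil_commute:
  "Poly_Mapping.single [] c * f = f * Poly_Mapping.single [] (c::'k::comm_ring_1)"
  by (induction f rule: free_alg_induct)
    (simp_all add: mult_single plus_list_def mult.commute algebra_simps)

lemma free_scale_add_right: "free_scale c (f + g) = free_scale c f + free_scale c g"
  by (simp add: free_scale_def distrib_left)

lemma free_scale_add_left: "free_scale (c + d) f = free_scale c f + free_scale d f"
  by (simp add: free_scale_def single_add distrib_right)

lemma free_scale_scale: "free_scale c (free_scale d f) = free_scale (c * d) f"
  by (simp add: free_scale_def mult.assoc[symmetric] mult_single plus_list_def)

lemma free_scale_one: "free_scale 1 f = f"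
  unfolding free_scale_def zero_list_def[symmetric] single_one by simp

lemma free_scale_mult_left: "free_scale c f * g = free_scale c (f * g)"
  by (simp add: free_scale_def mult.assoc)

lemma free_scale_mult_right: "f * free_scale c g = free_scale c (f * g)"
  by (metis free_scale_def mult.assoc single_Nil_commute)


definition two_sided_ideal :: "'a::ring_1 set \<Rightarrow> bool" where
  "two_sided_ideal I \<longleftrightarrow>
     0 \<in> I \<and> (\<forall>x\<in>I. \<forall>y\<in>I. x + y \<in> I) \<and> (\<forall>x\<in>I. \<forall>a. a * x \<in> I \<and> x * a \<in> I)"

definition cong_ideal :: "'a::ring_1 set \<Rightarrow> 'a \<Rightarrow> 'a \<Rightarrow> bool" where
  "cong_ideal I x y \<longleftrightarrow> x - y \<in> I"

lemma two_sided_ideal_hull: "two_sided_ideal (two_sided_ideal hull X)"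
  by (rule hull_in) (auto simp: two_sided_ideal_def)

context
  fixes I :: "'a::ring_1 set"
  assumes I: "two_sided_ideal I"
begin

lemma ideal_add: "x \<in> I \<Longrightarrow> y \<in> I \<Longrightarrow> x + y \<in> I"
  using I by (simp add: two_sided_ideal_def)

lemma ideal_mult_left: "x \<in> I \<Longrightarrow> a * x \<in> I"
  using I by (simp add: two_sided_ideal_def)

lemma ideal_mult_right: "x \<in> I \<Longrightarrow> x * a \<in> I"
  using I by (simp add: two_sided_ideal_def)

lemma ideal_uminus: "x \<in> I \<Longrightarrow> - x \<in> I"
  using ideal_mult_left[of x "- 1"] by simp

lemma cong_ideal_add:
  assumes "cong_ideal I x x'" "cong_ideal I y y'"
  shows "cong_ideal I (x + y) (x' + y')"
  using ideal_add[OF assms[unfolded cong_ideal_def]]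
  by (simp add: cong_ideal_def algebra_simps)

lemma cong_ideal_uminus:
  assumes "cong_ideal I x x'"
  shows "cong_ideal I (- x) (- x')"
  using ideal_uminus[OF assms[unfolded cong_ideal_def]]
  by (simp add: cong_ideal_def)

lemma cong_ideal_diff:
  assumes "cong_ideal I x x'" "cong_ideal I y y'"
  shows "cong_ideal I (x - y) (x' - y')"
  using cong_ideal_add[OF assms(1) cong_ideal_uminus[OF assms(2)]] by simp

lemma cong_ideal_mult:
  assumes "cong_ideal I x x'" "cong_ideal I y y'"
  shows "cong_ideal I (x * y) (x' * y')"
proof -
  have "x * y - x' * y' = (x - x') * y + x' * (y - y')"
    by (simp add: algebra_simps)
  then show ?thesis
    using ideal_add[OF ideal_mult_right[OF assms(1)[unfolded cong_ideal_def]]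
        ideal_mult_left[OF assms(2)[unfolded cong_ideal_def]]]
    by (simp add: cong_ideal_def)
qed

lemma equivp_cong_ideal: "equivp (cong_ideal I)"
proof (rule equivpI)
  show "reflp (cong_ideal I)"
    using I by (simp add: reflp_def cong_ideal_def two_sided_ideal_def)
  show "symp (cong_ideal I)"
    using ideal_uminus by (fastforce simp: symp_def cong_ideal_def)
  show "transp (cong_ideal I)"
    using ideal_add by (fastforce simp: transp_def cong_ideal_def)
qed

end

lemma cong_ideal_refl: "two_sided_ideal I \<Longrightarrow> cong_ideal I x x"
  by (simp add: cong_ideal_def two_sided_ideal_def)

lemma cong_ideal_scale:
  "two_sided_ideal I \<Longrightarrow> cong_ideal I f g \<Longrightarrow> cong_ideal I (free_scale c f) (free_scale c g)"
  by (simp add: free_scale_def cong_ideal_mult cong_ideal_refl)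


datatype generator = GenA | GenB | GenC

text \<open>An equation \<open>u = v\<close> between elements of the free algebra is encoded as \<open>u - v\<close>.\<close>

definition cyclic_relators :: "(generator, 'k::comm_ring_1) free_alg set" where
  "cyclic_relators =
     (let A = var GenA; B = var GenB; C = var GenC
      in {A * B * C * A - B * C * A * B, B * C * A * B - C * A * B * C})"

definition square_zero_relators :: "(generator, 'k::comm_ring_1) free_alg set" where
  "square_zero_relators =
     cyclic_relators \<union> {var GenA ^ 2, var GenB ^ 2, var GenC ^ 2}"

definition idempotent_relators :: "(generator, 'k::comm_ring_1) free_alg set" where
  "idempotent_relators =
     cyclic_relators \<union>
     {var GenA ^ 2 - var GenA, var GenB ^ 2 - var GenB, var GenC ^ 2 - var GenC}"


quotient_type (overloaded) 'k square_zero_alg = "(generator, 'k::comm_ring_1) free_alg" /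
    "cong_ideal (two_sided_ideal hull square_zero_relators)"
  by (rule equivp_cong_ideal[OF two_sided_ideal_hull])

instantiation square_zero_alg :: (comm_ring_1) "{ring, monoid_mult}"
begin

lift_definition zero_square_zero_alg :: "'a square_zero_alg" is 0 .

lift_definition one_square_zero_alg :: "'a square_zero_alg" is 1 .

lift_definition plus_square_zero_alg :: "'a square_zero_alg \<Rightarrow> 'a square_zero_alg \<Rightarrow> 'a square_zero_alg" is "(+)"
  by (rule cong_ideal_add[OF two_sided_ideal_hull])

lift_definition uminus_square_zero_alg :: "'a square_zero_alg \<Rightarrow> 'a square_zero_alg" is uminus
  by (rule cong_ideal_uminus[OF two_sided_ideal_hull])

lift_definition minus_square_zero_alg :: "'a square_zero_alg \<Rightarrow> 'a square_zero_alg \<Rightarrow> 'a square_zero_alg" is "(-)"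
  by (rule cong_ideal_diff[OF two_sided_ideal_hull])

lift_definition times_square_zero_alg :: "'a square_zero_alg \<Rightarrow> 'a square_zero_alg \<Rightarrow> 'a square_zero_alg" is "(*)"
  by (rule cong_ideal_mult[OF two_sided_ideal_hull])

instance
  by standard
    (transfer; simp add: algebra_simps cong_ideal_refl[OF two_sided_ideal_hull])+

end

lift_definition square_zero_scale :: "'k::comm_ring_1 \<Rightarrow> 'k square_zero_alg \<Rightarrow> 'k square_zero_alg" is free_scale
  by (rule cong_ideal_scale[OF two_sided_ideal_hull])

interpretation square_zero_alg: module "square_zero_scale :: 'k::comm_ring_1 \<Rightarrow> _"
  by standard
    (transfer; simp add: free_scale_add_right free_scale_add_left free_scale_scale
      free_scale_one cong_ideal_refl[OF two_sided_ideal_hull])+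

lemma square_zero_scale_mult:
  "square_zero_scale c x * y = square_zero_scale c (x * y)"
  "x * square_zero_scale c y = square_zero_scale c (x * y)"
  by (transfer; simp add: free_scale_mult_left free_scale_mult_right
      cong_ideal_refl[OF two_sided_ideal_hull])+


quotient_type (overloaded) 'k idempotent_alg = "(generator, 'k::comm_ring_1) free_alg" /
    "cong_ideal (two_sided_ideal hull idempotent_relators)"
  by (rule equivp_cong_ideal[OF two_sided_ideal_hull])

instantiation idempotent_alg :: (comm_ring_1) "{ring, monoid_mult}"
begin

lift_definition zero_idempotent_alg :: "'a idempotent_alg" is 0 .

lift_definition one_idempotent_alg :: "'a idempotent_alg" is 1 .

lift_definition plus_idempotent_alg :: "'a idempotent_alg \<Rightarrow> 'a idempotent_alg \<Rightarrow> 'a idempotent_alg" is "(+)"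
  by (rule cong_ideal_add[OF two_sided_ideal_hull])

lift_definition uminus_idempotent_alg :: "'a idempotent_alg \<Rightarrow> 'a idempotent_alg" is uminus
  by (rule cong_ideal_uminus[OF two_sided_ideal_hull])

lift_definition minus_idempotent_alg :: "'a idempotent_alg \<Rightarrow> 'a idempotent_alg \<Rightarrow> 'a idempotent_alg" is "(-)"
  by (rule cong_ideal_diff[OF two_sided_ideal_hull])

lift_definition times_idempotent_alg :: "'a idempotent_alg \<Rightarrow> 'a idempotent_alg \<Rightarrow> 'a idempotent_alg" is "(*)"
  by (rule cong_ideal_mult[OF two_sided_ideal_hull])

instance
  by standard
    (transfer; simp add: algebra_simps cong_ideal_refl[OF two_sided_ideal_hull])+

end

lift_definition idempotent_scale :: "'k::comm_ring_1 \<Rightarrow> 'k idempotent_alg \<Rightarrow> 'k idempotent_alg" is free_scale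
  by (rule cong_ideal_scale[OF two_sided_ideal_hull])

interpretation idempotent_alg: module "idempotent_scale :: 'k::comm_ring_1 \<Rightarrow> _"
  by standard
    (transfer; simp add: free_scale_add_right free_scale_add_left free_scale_scale
      free_scale_one cong_ideal_refl[OF two_sided_ideal_hull])+

lemma idempotent_scale_mult:
  "idempotent_scale c x * y = idempotent_scale c (x * y)"
  "x * idempotent_scale c y = idempotent_scale c (x * y)"
  by (transfer; simp add: free_scale_mult_left free_scale_mult_right
      cong_ideal_refl[OF two_sided_ideal_hull])+


definition finitely_generated_module ::
    "('k::comm_ring_1 \<Rightarrow> 'm::ab_group_add \<Rightarrow> 'm) \<Rightarrow> bool" where
  "finitely_generated_module scale \<longleftrightarrow>
     (\<exists>S. finite S \<and> module.span scale S = UNIV)"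

end

theory Submission
  imports Defs
begin

text \<open>Both algebras are infinite because the words \<open>ABAB\<dots>AB\<close> survive in them: they are
  linearly independent, for a reason that involves no rewriting theory. They contain no \<open>C\<close>,
  whereas both sides of every cyclic relation do, so these relations never touch them. They also
  have no two equal adjacent letters. If the generators square to zero, no relation
  applies to \<open>(AB)\<^sup>n\<close> at all, and its coefficient is a linear functional that vanishes on the
  ideal of relations. If the generators are idempotent, the relations identify \<open>(AB)\<^sup>n\<close> exactly
  with the words that become \<open>(AB)\<^sup>n\<close> when runs of equal letters are collapsed
  (\<^const>\<open>remdups_adj\<close>), and the sum of the coefficients of all these words is such a functional.

  In either case there results a sequence of nonzero functionals on the quotient, one for each
  \<open>n\<close>, and on any fixed element only finitely many of them are nonzero, since a representative
  involves finitely many words and a word counts for at most one \<open>n\<close>. On a finitely generated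
  module all but finitely many of them would vanish on every generator, hence everywhere.\<close>

section \<open>A criterion for infinite generation\<close>

lemma not_finitely_generated_if_locally_finite_functionals:
  fixes scale :: "'k::comm_ring_1 \<Rightarrow> 'm::ab_group_add \<Rightarrow> 'm"
    and \<phi> :: "'i \<Rightarrow> 'm \<Rightarrow> 'k"
  assumes "module scale"
    and inf: "infinite (UNIV :: 'i set)"
    and add: "\<And>n x y. \<phi> n (x + y) = \<phi> n x + \<phi> n y"
    and scale: "\<And>n c x. \<phi> n (scale c x) = c * \<phi> n x"
    and fin: "\<And>x. finite {n. \<phi> n x \<noteq> 0}"
    and nonzero: "\<And>n. \<exists>x. \<phi> n x \<noteq> 0"
  shows "\<not> finitely_generated_module scale"
proof
  interpret module scale by fact
  assume "finitely_generated_module scale"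
  then obtain S where S: "finite S" "span S = UNIV"
    by (auto simp: finitely_generated_module_def)
  have "finite (\<Union>x\<in>S. {n. \<phi> n x \<noteq> 0})"
    using S(1) fin by blast
  then obtain n where "n \<notin> (\<Union>x\<in>S. {n. \<phi> n x \<noteq> 0})"
    using inf by (meson UNIV_I finite_subset subsetI)
  then have "S \<subseteq> {x. \<phi> n x = 0}"
    by auto
  moreover have "subspace {x. \<phi> n x = 0}"
    using add[of n 0 0] by (auto simp: subspace_def add scale)
  ultimately have "span S \<subseteq> {x. \<phi> n x = 0}"
    by (rule span_minimal)
  with S(2) nonzero[of n] show False by auto
qed

section \<open>Sums of coefficients over a set of words\<close>

definition coeff_sum :: "'x list set \<Rightarrow> ('x, 'k::comm_ring_1) free_alg \<Rightarrow> 'k" where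
  "coeff_sum W f = (\<Sum>w \<in> Poly_Mapping.keys f \<inter> W. Poly_Mapping.lookup f w)"

lemma coeff_sum_superset:
  assumes "finite K" "Poly_Mapping.keys f \<subseteq> K"
  shows "coeff_sum W f = (\<Sum>w \<in> K \<inter> W. Poly_Mapping.lookup f w)"
  unfolding coeff_sum_def using assms
  by (intro sum.mono_neutral_left) (auto simp: in_keys_iff)

lemma coeff_sum_zero [simp]: "coeff_sum W 0 = 0"
  by (simp add: coeff_sum_def)

lemma coeff_sum_add: "coeff_sum W (f + g) = coeff_sum W f + coeff_sum W g"
proof -
  let ?K = "Poly_Mapping.keys f \<union> Poly_Mapping.keys g"
  have "finite ?K" by simp
  then show ?thesis
    using Poly_Mapping.keys_add[of f g]
    by (simp add: coeff_sum_superset[of ?K] lookup_add sum.distrib)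
qed

lemma coeff_sum_diff: "coeff_sum W (f - g) = coeff_sum W f - coeff_sum W g"
  using coeff_sum_add[of W "f - g" g] by simp

lemma coeff_sum_single [simp]:
  "coeff_sum W (Poly_Mapping.single w c) = (if w \<in> W then c else 0)"
  by (subst coeff_sum_superset[of "{w}"]) auto

lemma coeff_sum_scale: "coeff_sum W (free_scale c f) = c * coeff_sum W f"
  by (induction f rule: free_alg_induct)
    (simp_all add: free_scale_def distrib_left coeff_sum_add mult_single plus_list_def)

lemma finite_nonzero_coeff_sums:
  assumes disj: "\<And>w m n. w \<in> W m \<Longrightarrow> w \<in> W n \<Longrightarrow> m = n"
  shows "finite {n. coeff_sum (W n) f \<noteq> 0}"
proof (induction f rule: free_alg_induct)
  case zero
  then show ?case by simp
next
  case (add w c f)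
  have "finite {n. w \<in> W n}"
  proof (cases "\<exists>m. w \<in> W m")
    case True
    then obtain m where "w \<in> W m" ..
    with disj have "{n. w \<in> W n} \<subseteq> {m}" by blast
    then show ?thesis by (rule finite_subset) simp
  qed simp
  moreover have "{n. coeff_sum (W n) (Poly_Mapping.single w c + f) \<noteq> 0}
      \<subseteq> {n. w \<in> W n} \<union> {n. coeff_sum (W n) f \<noteq> 0}"
    by (auto simp: coeff_sum_add)
  ultimately show ?case
    using add by (meson finite_UnI finite_subset)
qed

text \<open>The ideal is spanned by the products \<open>a * r * b\<close> with \<open>r\<close> a relator. Each is linear in \<open>a\<close> and in
  \<open>b\<close>, so it suffices to test \<open>a\<close> and \<open>b\<close> running over words.\<close>

lemma coeff_sum_eq_0_on_hull:
  fixes R :: "('x, 'k::comm_ring_1) free_alg set"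
  assumes R: "\<And>r u v. r \<in> R \<Longrightarrow>
      coeff_sum W (Poly_Mapping.single u 1 * r * Poly_Mapping.single v 1) = 0"
    and x: "x \<in> two_sided_ideal hull R"
  shows "coeff_sum W x = 0"
proof -
  \<comment> \<open>The kernel of the functional need not be an ideal; this is the largest ideal inside it.\<close>
  define J where "J = {x :: ('x, 'k) free_alg. \<forall>a b. coeff_sum W (a * x * b) = 0}"
  have single: "Poly_Mapping.single w c = free_scale c (Poly_Mapping.single w 1)"
    for w :: "'x list" and c :: 'k
    by (simp add: free_scale_def mult_single plus_list_def)
  have word_left: "coeff_sum W (Poly_Mapping.single u 1 * r * b) = 0" if "r \<in> R" for r u b
  proof (induction b rule: free_alg_induct)
    case (add v c b)
    then show ?case
      unfolding single[of v c]
      by (simp add: distrib_left coeff_sum_add free_scale_mult_right coeff_sum_scale R[OF that])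
  qed simp
  have "coeff_sum W (a * r * b) = 0" if "r \<in> R" for r a b
  proof (induction a rule: free_alg_induct)
    case (add u c a)
    then show ?case
      unfolding single[of u c]
      by (simp add: distrib_right coeff_sum_add free_scale_mult_left coeff_sum_scale
          word_left[OF that])
  qed simp
  then have "R \<subseteq> J" by (auto simp: J_def)
  moreover have "two_sided_ideal J"
    unfolding two_sided_ideal_def J_def
  proof (intro conjI ballI allI CollectI; (elim CollectE)?)
    fix x c a b :: "('x, 'k) free_alg"
    assume x: "\<forall>a b. coeff_sum W (a * x * b) = 0"
    have "a * (c * x) * b = (a * c) * x * b" "a * (x * c) * b = a * x * (c * b)"
      by (simp_all only: mult.assoc)
    then show "coeff_sum W (a * (c * x) * b) = 0" "coeff_sum W (a * (x * c) * b) = 0"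
      using x by simp_all
  qed (simp_all add: distrib_left distrib_right coeff_sum_add)
  ultimately have "two_sided_ideal hull R \<subseteq> J"
    by (rule hull_minimal)
  with x have "coeff_sum W (1 * x * 1) = 0"
    unfolding J_def by blast
  then show ?thesis by simp
qed

lemma coeff_sum_cong:
  assumes "\<And>x. x \<in> I \<Longrightarrow> coeff_sum W x = 0" "cong_ideal I f g"
  shows "coeff_sum W f = coeff_sum W g"
  using assms(1)[OF assms(2)[unfolded cong_ideal_def]] by (simp add: coeff_sum_diff)

text \<open>Placed between two words, a cyclic relator is a difference of two words that both
  contain \<open>C\<close>, and such words are not counted.\<close>

lemma coeff_sum_cyclic_relator:
  assumes "r \<in> cyclic_relators" and no_C: "\<And>w. w \<in> W \<Longrightarrow> GenC \<notin> set w"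
  shows "coeff_sum W (Poly_Mapping.single u 1 * r * Poly_Mapping.single v 1) = 0"
proof -
  have notin: "u @ p @ v \<notin> W" if "GenC \<in> set p" for p
    using no_C[of "u @ p @ v"] that by auto
  show ?thesis
    using assms(1) notin[of "[GenA, GenB, GenC, GenA]"] notin[of "[GenB, GenC, GenA, GenB]"]
      notin[of "[GenC, GenA, GenB, GenC]"]
    by (auto simp: cyclic_relators_def var_def mult_single plus_list_def
        left_diff_distrib right_diff_distrib coeff_sum_diff)
qed

section \<open>The alternating words\<close>

definition AB_power :: "nat \<Rightarrow> generator list" where
  "AB_power n = concat (replicate n [GenA, GenB])"

lemma AB_power_inject: "AB_power m = AB_power n \<longleftrightarrow> m = n"
proof -
  have "length (AB_power n) = 2 * n" for n
    by (induction n) (simp_all add: AB_power_def)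
  then show ?thesis by (metis mult_cancel1 zero_neq_numeral)
qed

lemma GenC_notin_AB_power: "GenC \<notin> set (AB_power n)"
  by (auto simp: AB_power_def)

lemma distinct_adj_AB_power: "distinct_adj (AB_power n)"
proof (induction n)
  case (Suc n)
  have "AB_power n = [] \<or> hd (AB_power n) = GenA"
    by (cases n) (simp_all add: AB_power_def)
  with Suc show ?case
    by (auto simp: AB_power_def distinct_adj_Cons)
qed (simp add: AB_power_def)

section \<open>Generators of square zero\<close>

text \<open>A word with a factor \<open>yy\<close> is never \<open>(AB)\<^sup>n\<close>, so the relations \<open>y\<^sup>2 = 0\<close> do not affect
  the coefficient of \<open>(AB)\<^sup>n\<close>.\<close>

lemma coeff_sum_square_zero_ideal:
  assumes "x \<in> two_sided_ideal hull square_zero_relators"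
  shows "coeff_sum {AB_power n} x = 0"
proof (rule coeff_sum_eq_0_on_hull[OF _ assms])
  fix r :: "(generator, 'a) free_alg" and u v :: "generator list"
  assume r: "r \<in> square_zero_relators"
  have "u @ y # y # v \<noteq> AB_power n" for y
    using distinct_adj_AB_power[of n] by (metis distinct_adj_Cons_Cons distinct_adj_appendD2)
  moreover have "coeff_sum {AB_power n} (Poly_Mapping.single u 1 * r * Poly_Mapping.single v 1) = 0"
    if "r \<in> cyclic_relators"
    using that by (rule coeff_sum_cyclic_relator) (simp add: GenC_notin_AB_power)
  ultimately show "coeff_sum {AB_power n} (Poly_Mapping.single u 1 * r * Poly_Mapping.single v 1) = 0"
    using r
    by (auto simp: square_zero_relators_def power2_eq_square var_def mult_single plus_list_def)
qed

lift_definition square_zero_coeff :: "nat \<Rightarrow> 'k::comm_ring_1 square_zero_alg \<Rightarrow> 'k"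
  is "\<lambda>n. coeff_sum {AB_power n}"
  by (rule coeff_sum_cong[OF coeff_sum_square_zero_ideal])

lemma square_zero_alg_not_finitely_generated:
  "\<not> finitely_generated_module
      (square_zero_scale :: 'k::comm_ring_1 \<Rightarrow> 'k square_zero_alg \<Rightarrow> 'k square_zero_alg)"
proof (rule not_finitely_generated_if_locally_finite_functionals
    [where \<phi> = square_zero_coeff, OF square_zero_alg.module_axioms infinite_UNIV_nat])
  show "finite {n. square_zero_coeff n x \<noteq> 0}" for x :: "'k square_zero_alg"
    by transfer (rule finite_nonzero_coeff_sums, simp add: AB_power_inject)
  show "\<exists>x :: 'k square_zero_alg. square_zero_coeff n x \<noteq> 0" for n
    by (transfer fixing: n) (rule exI[of _ "Poly_Mapping.single (AB_power n) 1"], simp)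
qed (transfer; simp add: coeff_sum_add coeff_sum_scale)+

section \<open>Idempotent generators\<close>

definition collapsing_to_AB_power :: "nat \<Rightarrow> generator list set" where
  "collapsing_to_AB_power n = {w. remdups_adj w = AB_power n}"

text \<open>Replacing a factor \<open>yy\<close> by \<open>y\<close> does not change the collapsed word, so the relations
  \<open>y\<^sup>2 = y\<close> move coefficients only within the set over which they are summed, or outside it.\<close>

lemma coeff_sum_idempotent_ideal:
  assumes "x \<in> two_sided_ideal hull idempotent_relators"
  shows "coeff_sum (collapsing_to_AB_power n) x = 0"
proof (rule coeff_sum_eq_0_on_hull[OF _ assms])
  fix r :: "(generator, 'a) free_alg" and u v :: "generator list"
  assume r: "r \<in> idempotent_relators"
  have no_C: "GenC \<notin> set w" if "w \<in> collapsing_to_AB_power n" for w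
    using that GenC_notin_AB_power[of n] remdups_adj_set[of w]
    by (simp add: collapsing_to_AB_power_def)
  have "remdups_adj (u @ y # y # v) = remdups_adj (u @ y # v)" for y
    by (simp add: remdups_adj_append[of u y "y # v"] remdups_adj_append[of u y v])
  with r coeff_sum_cyclic_relator[where W = "collapsing_to_AB_power n", OF _ no_C] show "coeff_sum (collapsing_to_AB_power n)
      (Poly_Mapping.single u 1 * r * Poly_Mapping.single v 1) = 0"
    by (auto simp: idempotent_relators_def collapsing_to_AB_power_def power2_eq_square var_def mult_single plus_list_def
        left_diff_distrib right_diff_distrib coeff_sum_diff)
qed

lift_definition idempotent_coeff :: "nat \<Rightarrow> 'k::comm_ring_1 idempotent_alg \<Rightarrow> 'k"
  is "\<lambda>n. coeff_sum (collapsing_to_AB_power n)"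
  by (rule coeff_sum_cong[OF coeff_sum_idempotent_ideal])

lemma idempotent_alg_not_finitely_generated:
  "\<not> finitely_generated_module
      (idempotent_scale :: 'k::comm_ring_1 \<Rightarrow> 'k idempotent_alg \<Rightarrow> 'k idempotent_alg)"
proof (rule not_finitely_generated_if_locally_finite_functionals
    [where \<phi> = idempotent_coeff, OF idempotent_alg.module_axioms infinite_UNIV_nat])
  show "finite {n. idempotent_coeff n x \<noteq> 0}" for x :: "'k idempotent_alg"
    by transfer
      (rule finite_nonzero_coeff_sums, simp add: collapsing_to_AB_power_def AB_power_inject)
  have "AB_power n \<in> collapsing_to_AB_power n" for n
    by (simp add: collapsing_to_AB_power_def distinct_adj_AB_power flip: distinct_adj_altdef)
  then show "\<exists>x :: 'k idempotent_alg. idempotent_coeff n x \<noteq> 0" for n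
    by (transfer fixing: n) (rule exI[of _ "Poly_Mapping.single (AB_power n) 1"], simp)
qed (transfer; simp add: coeff_sum_add coeff_sum_scale)+

theorem proposition3p5:
  shows "\<not> finitely_generated_module
             (square_zero_scale :: 'k::comm_ring_1 \<Rightarrow> 'k square_zero_alg \<Rightarrow> 'k square_zero_alg)
       \<and> \<not> finitely_generated_module
             (idempotent_scale :: 'k::comm_ring_1 \<Rightarrow> 'k idempotent_alg \<Rightarrow> 'k idempotent_alg)"
  using square_zero_alg_not_finitely_generated idempotent_alg_not_finitely_generated by blast

end
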